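(* Let $d\geq 1$ and let $I=\{i_1,\ldots,i_d\}$, $J=\{j_1,\ldots,j_d\}$ with $0\leq i_1<\cdots<i_d$ and $0\leq j_1<\cdots<j_d$ integers. Suppose $J\leq I$. Then \[ b^I_J=\pi^I_J\cdot\sum_{(k_2,\ldots,k_d)\in [i_1-j_1,\,i_2-j_1-1]\times\cdots\times[i_{d-1}-j_1,\,i_d-j_1-1]} b^{\{k_2,\ldots,k_d\}}_{\{j_2-j_1-1,\ldots,j_d-j_1-1\}}. \]
   Context: For integers $p,q\geq 0$, $b_{p,q}=\binom{p}{q}$, with $b_{p,q}=0$ if $q>p$. For finite sets $I=\{i_1<\cdots<i_d\}$ and $J=\{j_1<\cdots<j_d\}$ of non-negative integers, $b^I_J$ denotes the determinant of the $d\times d$ matrix whose $(r,s)$ entry is $b_{i_r,j_s}$ (the determinant of the empty $0\times 0$ matrix is $1$). We write $J\leq I$ if $j_k\leq i_k$ for all $k$. When $J\leq I$, $\pi^I_J=\frac{b_{i_1,j_1}\cdots b_{i_d,j_1}}{b_{j_1,j_1}\cdots b_{j_d,j_1}}$. For integers $k\leq l$, $[k,l]=\{k,k+1,\ldots,l\}$, and $[k,l]=\emptyset$ if $k>l$. Note that for each tuple in the sum, $k_2<k_3<\cdots<k_d$ automatically; when $d=1$ the sum consists of a single term equal to $1$. *)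

theory Defs
  imports "Jordan_Normal_Form.Determinant" "HOL-Library.FuncSet"
begin

text \<open>
  For finite \<open>I = {i_1 < ... < i_d}\<close>, the element \<open>i_(r+1)\<close> is \<open>sorted_list_of_set I ! r\<close>:
  matrices and lists are indexed from \<open>0\<close>. Values are rational because
  \<open>binom_pi I J\<close> need not be an integer, e.g. \<open>I = {1, 3}\<close>, \<open>J = {1, 2}\<close>.
\<close>

definition binom_minor :: "nat set \<Rightarrow> nat set \<Rightarrow> rat" where
  "binom_minor I J = det (mat (card I) (card J)
     (\<lambda>(r, s). of_nat (sorted_list_of_set I ! r choose sorted_list_of_set J ! s)))"

definition set_le :: "nat set \<Rightarrow> nat set \<Rightarrow> bool" where
  "set_le J I \<longleftrightarrow> card J = card I \<and>
     (\<forall>k<card I. sorted_list_of_set J ! k \<le> sorted_list_of_set I ! k)"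

text \<open>Only meaningful for nonempty \<open>J\<close>, where \<open>Min J\<close> is the element \<open>j_1\<close>.\<close>

definition binom_pi :: "nat set \<Rightarrow> nat set \<Rightarrow> rat" where
  "binom_pi I J =
     (\<Prod>i\<in>I. of_nat (i choose Min J)) / (\<Prod>j\<in>J. of_nat (j choose Min J))"

end

theory Submission
  imports Defs
begin

text \<open>
  The identity \<open>(p choose q) (q choose m) = (p choose m) ((p - m) choose (q - m))\<close> with \<open>m = j_1\<close>
  lets one pull the factor \<open>binom_pi I J\<close> out of the rows and columns, leaving the minor on the
  shifted sets \<open>I - j_1\<close> and \<open>J - j_1\<close>. Its first column consists of ones. Subtracting from each
  row the previous one removes that column, and the remaining entries are the hockey-stick sums
  \<open>(l' choose (b + 1)) - (l choose (b + 1)) = (\<Sum>k = l..<l'. k choose b)\<close>, so that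
  multilinearity in the rows gives the sum over tuples.
\<close>

section \<open>Determinant identities\<close>

text \<open>A permutation meets every row and every column exactly once, so each term of the Leibniz
  expansion carries the same factor.\<close>

lemma det_scale_rows_columns:
  fixes f :: "nat \<Rightarrow> nat \<Rightarrow> 'a :: comm_ring_1"
  shows "det (mat n n (\<lambda>(r, s). u r * v s * f r s)) =
    (\<Prod>r<n. u r) * (\<Prod>s<n. v s) * det (mat n n (\<lambda>(r, s). f r s))"
proof -
  have "(\<Prod>r = 0..<n. mat n n (\<lambda>(r, s). u r * v s * f r s) $$ (r, p r)) =
      (\<Prod>r<n. u r) * (\<Prod>s<n. v s) * (\<Prod>r = 0..<n. mat n n (\<lambda>(r, s). f r s) $$ (r, p r))"
    if p: "p permutes {0..<n}" for p
  proof -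
    have lt: "p r < n" if "r < n" for r
      using permutes_in_image[OF p, of r] that by simp
    have "(\<Prod>r = 0..<n. v (p r)) = (\<Prod>s = 0..<n. v s)"
      using prod.permute[OF p, of v] by (simp add: comp_def)
    then show ?thesis
      by (simp add: lt prod.distrib lessThan_atLeast0)
  qed
  then show ?thesis
    by (simp add: det_def'[OF mat_carrier] sum_distrib_left ac_simps)
qed

text \<open>Multilinearity in all rows at once: each Leibniz term is a product of sums, which
  distributes over choice functions. The bijection \<open>g\<close> lets these functions live on an
  index set \<open>X\<close> other than the row numbers.\<close>

lemma det_sum_rows:
  fixes f :: "'b \<Rightarrow> nat \<Rightarrow> 'a :: comm_ring_1"
  assumes "bij_betw g {0..<n} X" and "\<And>x. x \<in> X \<Longrightarrow> finite (K x)"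
  shows "det (mat n n (\<lambda>(r, s). \<Sum>k\<in>K (g r). f k s)) =
    (\<Sum>k\<in>Pi\<^sub>E X K. det (mat n n (\<lambda>(r, s). f (k (g r)) s)))"
proof -
  have finX: "finite X"
    using assms(1) bij_betw_finite by blast
  have "(\<Prod>r = 0..<n. mat n n (\<lambda>(r, s). \<Sum>k\<in>K (g r). f k s) $$ (r, p r)) =
      (\<Sum>k\<in>Pi\<^sub>E X K. \<Prod>r = 0..<n. mat n n (\<lambda>(r, s). f (k (g r)) s) $$ (r, p r))"
    if p: "p permutes {0..<n}" for p
  proof -
    \<comment> \<open>\<open>h\<close> recovers the row from its index in \<open>X\<close>, so that
      the column \<open>p r\<close> can be written in terms of \<open>g r\<close> and the product
      reindexed.\<close>
    define h where "h = inv_into {0..<n} g"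
    have h: "h (g r) = r" if "r \<in> {0..<n}" for r
      using assms(1) that by (simp add: h_def bij_betw_inv_into_left)
    have lt: "p r < n" if "r < n" for r
      using permutes_in_image[OF p, of r] that by simp
    have "(\<Prod>r = 0..<n. \<Sum>k\<in>K (g r). f k (p r)) = (\<Prod>r = 0..<n. \<Sum>k\<in>K (g r). f k (p (h (g r))))"
      by (simp add: h)
    also have "\<dots> = (\<Prod>x\<in>X. \<Sum>k\<in>K x. f k (p (h x)))"
      by (rule prod.reindex_bij_betw[OF assms(1)])
    also have "\<dots> = (\<Sum>k\<in>Pi\<^sub>E X K. \<Prod>x\<in>X. f (k x) (p (h x)))"
      using finX assms(2) by (rule prod_sum_PiE)
    also have "\<dots> = (\<Sum>k\<in>Pi\<^sub>E X K. \<Prod>r = 0..<n. f (k (g r)) (p (h (g r))))"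
      by (intro sum.cong refl prod.reindex_bij_betw[OF assms(1), symmetric])
    also have "\<dots> = (\<Sum>k\<in>Pi\<^sub>E X K. \<Prod>r = 0..<n. f (k (g r)) (p r))"
      by (simp add: h)
    finally show ?thesis
      by (simp add: lt)
  qed
  then have "det (mat n n (\<lambda>(r, s). \<Sum>k\<in>K (g r). f k s)) =
      (\<Sum>p | p permutes {0..<n}. \<Sum>k\<in>Pi\<^sub>E X K.
        signof p * (\<Prod>r = 0..<n. mat n n (\<lambda>(r, s). f (k (g r)) s) $$ (r, p r)))"
    by (simp add: det_def'[OF mat_carrier] sum_distrib_left)
  also have "\<dots> = (\<Sum>k\<in>Pi\<^sub>E X K. det (mat n n (\<lambda>(r, s). f (k (g r)) s)))"
    by (subst sum.swap) (simp add: det_def'[OF mat_carrier])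
  finally show ?thesis .
qed

text \<open>Row differences turn the first column into 1, 0, ..., 0; expanding along it leaves the
  remaining differences.\<close>

lemma det_column_ones:
  fixes f :: "nat \<Rightarrow> nat \<Rightarrow> 'a :: idom"
  assumes "\<And>r. r \<le> n \<Longrightarrow> f r 0 = 1"
  shows "det (mat (Suc n) (Suc n) (\<lambda>(r, s). f r s)) =
    det (mat n n (\<lambda>(r, s). f (Suc r) (Suc s) - f r (Suc s)))"
proof -
  let ?M = "mat (Suc n) (Suc n) (\<lambda>(r, s). f r s)"
  \<comment> \<open>Left multiplication by this unitriangular matrix subtracts from each row the one
    above and keeps row 0.\<close>
  define L where "L = mat (Suc n) (Suc n)
    (\<lambda>(r, s). if r = s then 1 else if r = Suc s then - 1 else (0::'a))"
  define N where
    "N = mat (Suc n) (Suc n) (\<lambda>(r, s). if r = 0 then f 0 s else f r s - f (r - 1) s)"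
  have L: "L \<in> carrier_mat (Suc n) (Suc n)"
    by (simp add: L_def)
  have "det L = 1"
  proof -
    have "det L = prod_list (diag_mat L)"
      by (rule det_lower_triangular[OF _ L]) (simp add: L_def)
    also have "\<dots> = 1"
      by (simp add: L_def prod_list_diag_prod)
    finally show ?thesis .
  qed
  moreover have "L * ?M = N"
  proof (rule eq_matI)
    fix r s assume "r < dim_row N" "s < dim_col N"
    then have rs: "r < Suc n" "s < Suc n"
      by (simp_all add: N_def)
    have "(L * ?M) $$ (r, s) = (\<Sum>t = 0..<Suc n. L $$ (r, t) * f t s)"
      using rs by (simp add: L_def scalar_prod_def)
    \<comment> \<open>The guard \<open>r \<noteq> 0\<close> matters: on naturals
      \<open>0 - 1 = 0\<close>, so row 0 would otherwise cancel itself.\<close>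
    also have "\<dots> = (\<Sum>t = 0..<Suc n. (if t = r then f t s else 0) -
        (if r \<noteq> 0 \<and> t = r - 1 then f t s else 0))"
      using rs by (intro sum.cong) (auto simp: L_def)
    also have "\<dots> = N $$ (r, s)"
      using rs by (simp add: sum_subtractf N_def del: sum.op_ivl_Suc)
    finally show "(L * ?M) $$ (r, s) = N $$ (r, s)" .
  qed (simp_all add: L_def N_def)
  ultimately have "det ?M = det N"
    using det_mult[OF L, of ?M] by simp
  also have "\<dots> = (\<Sum>r<Suc n. N $$ (r, 0) * cofactor N r 0)"
    by (rule laplace_expansion_column[of N "Suc n"]) (simp_all add: N_def)
  also have "\<dots> = (\<Sum>r<Suc n. if r = 0 then cofactor N r 0 else 0)"
    using assms by (intro sum.cong) (auto simp: N_def)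
  also have "\<dots> = det (mat_delete N 0 0)"
    by (simp add: cofactor_def del: sum.lessThan_Suc)
  also have "mat_delete N 0 0 = mat n n (\<lambda>(r, s). f (Suc r) (Suc s) - f r (Suc s))"
    by (rule eq_matI) (auto simp: N_def mat_delete_def)
  finally show ?thesis .
qed

section \<open>Binomial coefficients\<close>

text \<open>Pascal's rule telescopes. The additive form avoids truncated subtraction.\<close>

lemma sum_choose_upper_interval:
  assumes "l \<le> m"
  shows "(\<Sum>k = l..<m. k choose b) + (l choose Suc b) = m choose Suc b"
  using assms by (induction m rule: dec_induct) simp_all

text \<open>If \<open>q > p\<close>, both sides vanish, since \<open>m \<le> p\<close> gives
  \<open>q - m > p - m\<close>. This case can occur off the diagonal of the minor.\<close>

lemma choose_mult_shift:
  assumes "m \<le> p" "m \<le> q"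
  shows "(p choose q) * (q choose m) = (p choose m) * ((p - m) choose (q - m))"
proof (cases "q \<le> p")
  case True
  then show ?thesis
    using choose_mult[OF assms(2)] by simp
next
  case False
  then show ?thesis
    using assms by (simp add: binomial_eq_0)
qed

section \<open>Minors of sets enumerated by increasing maps\<close>

lemma sorted_list_of_set_image_strict_mono_on:
  fixes f :: "nat \<Rightarrow> nat"
  assumes "strict_mono_on {a..b} f"
  shows "sorted_list_of_set (f ` {a..b}) = map f [a..<Suc b]"
proof (rule sorted_distinct_set_unique)
  have "sorted_wrt (<) (map f [a..<Suc b])"
    unfolding sorted_wrt_map
    by (rule sorted_wrt_mono_rel[OF _ sorted_wrt_upt])
      (use assms in \<open>auto simp: strict_mono_on_def less_Suc_eq_le\<close>)
  then show "sorted (map f [a..<Suc b])" "distinct (map f [a..<Suc b])"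
    by (simp_all only: strict_sorted_iff)
  show "set (sorted_list_of_set (f ` {a..b})) = set (map f [a..<Suc b])"
    by (simp only: set_sorted_list_of_set finite_imageI finite_atLeastAtMost set_map set_upt
        atLeastLessThanSuc_atLeastAtMost)
qed simp_all

lemma binom_minor_image:
  assumes "strict_mono_on {a..b} i" "strict_mono_on {a..b} j"
  shows "binom_minor (i ` {a..b}) (j ` {a..b}) =
    det (mat (Suc b - a) (Suc b - a) (\<lambda>(r, s). of_nat (i (a + r) choose j (a + s))))"
proof -
  have "card (i ` {a..b}) = Suc b - a" "card (j ` {a..b}) = Suc b - a"
    using assms by (simp_all add: card_image strict_mono_on_imp_inj_on)
  then show ?thesis
    unfolding binom_minor_def
    by (intro arg_cong[of _ _ det] eq_matI)
      (simp_all add: assms sorted_list_of_set_image_strict_mono_on del: upt_Suc)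
qed

theorem theorem2p3:
  fixes d :: nat and i j :: "nat \<Rightarrow> nat" and I J :: "nat set"
  assumes "d \<ge> 1"
    and "strict_mono_on {1..d} i" and "I = i ` {1..d}"
    and "strict_mono_on {1..d} j" and "J = j ` {1..d}"
    and "set_le J I"
  shows "binom_minor I J = binom_pi I J *
    (\<Sum>k\<in>(\<Pi>\<^sub>E r\<in>{2..d}. {i (r - 1) - j 1 .. i r - j 1 - 1}).
      binom_minor (k ` {2..d}) ((\<lambda>r. j r - j 1 - 1) ` {2..d}))"
proof -
  obtain n where d: "d = Suc n"
    using assms(1) by (cases d) auto
  \<comment> \<open>\<open>a\<close> and \<open>b\<close> enumerate the sets shifted by j_1, counted
    from 0; in particular \<open>b 0 = 0\<close>.\<close>
  define m where "m = j 1"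
  define a where "a r = i (Suc r) - m" for r
  define b where "b s = j (Suc s) - m" for s
  have i_less: "i r < i s" if "1 \<le> r" "r < s" "s \<le> d" for r s
    using assms(2) that by (auto simp: strict_mono_on_def)
  have j_less: "j r < j s" if "1 \<le> r" "r < s" "s \<le> d" for r s
    using assms(4) that by (auto simp: strict_mono_on_def)
  have inj: "inj_on i {1..d}" "inj_on j {1..d}"
    using assms(2,4) strict_mono_on_imp_inj_on by auto
  \<comment> \<open>Comparing the least elements gives j_1 \<le> i_1, so subtracting
    \<open>m\<close> from any \<open>i r\<close> does not truncate.\<close>
  have "0 < card I"
    using inj assms(1,3) by (simp add: card_image)
  then have "sorted_list_of_set J ! 0 \<le> sorted_list_of_set I ! 0"
    using assms(6) by (simp add: set_le_def)
  then have "m \<le> i 1"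
    using assms(1)
    unfolding assms(3,5) sorted_list_of_set_image_strict_mono_on[OF assms(2)]
      sorted_list_of_set_image_strict_mono_on[OF assms(4)]
    by (simp add: m_def del: upt_Suc)
  then have m_i: "m \<le> i r" if "1 \<le> r" "r \<le> d" for r
    using i_less[of 1 r] that by (cases "r = 1") auto
  have m_j: "m \<le> j r" if "1 \<le> r" "r \<le> d" for r
    using j_less[of 1 r] that by (cases "r = 1") (auto simp: m_def)
  have a_less: "a r < a (Suc r)" if "r < n" for r
    using i_less[of "Suc r" "Suc (Suc r)"] m_i[of "Suc r"] that by (simp add: a_def d)
  have b_pos: "0 < b (Suc s)" if "s < n" for s
    using j_less[of 1 "Suc (Suc s)"] that by (simp add: b_def m_def d)
  have Min_J: "Min J = m"
    using m_j assms(1,5) by (intro Min_eqI) (auto simp: m_def)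

  let ?K = "\<lambda>r. {i (r - 1) - j 1 .. i r - j 1 - 1}"
  \<comment> \<open>Here \<open>a (Suc r) > 0\<close>, so the upper end \<open>a (Suc r) - 1\<close>
    is exact and the interval becomes half-open, as the hockey-stick sum requires.\<close>
  have K: "?K (r + 2) = {a r..<a (Suc r)}" if "r < n" for r
    using a_less[OF that] by (auto simp: a_def m_def)
  have minor: "det (mat n n (\<lambda>(r, s). of_nat (k (r + 2) choose (b (Suc s) - 1)))) =
      binom_minor (k ` {2..d}) ((\<lambda>r. j r - j 1 - 1) ` {2..d})"
    if k: "k \<in> Pi\<^sub>E {2..d} ?K" for k
  proof -
    \<comment> \<open>The intervals lie in increasing order:
      \<open>k r \<le> i r - m - 1 < i (s - 1) - m \<le> k s\<close>, where \<open>m < i r\<close>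
      keeps the first bound exact. Hence \<open>k\<close> enumerates its image in increasing
      order.\<close>
    have "k r < k s" if rs: "2 \<le> r" "r < s" "s \<le> d" for r s
    proof -
      have "k r \<in> ?K r" "k s \<in> ?K s"
        using k rs by (auto simp: PiE_iff)
      moreover have "i r \<le> i (s - 1)"
      proof (cases "r = s - 1")
        case False
        then have "i r < i (s - 1)"
          using rs by (intro i_less) linarith+
        then show ?thesis
          by simp
      qed simp
      moreover have "m < i r"
        using i_less[of 1 r] m_i[of 1] rs by simp
      ultimately show ?thesis
        by (auto simp: m_def)
    qed
    then have "strict_mono_on {2..d} k"
      by (auto simp: strict_mono_on_def)
    moreover have "strict_mono_on {2..d} (\<lambda>r. j r - j 1 - 1)"
    proof (rule strict_mono_onI)
      fix r s assume rs: "r \<in> {2..d}" "s \<in> {2..d}" "r < s"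
      then have "j 1 < j r" "j r < j s"
        by (auto intro!: j_less)
      then show "j r - j 1 - 1 < j s - j 1 - 1"
        by linarith
    qed
    ultimately show ?thesis
      by (simp add: binom_minor_image d b_def m_def)
  qed

  \<comment> \<open>The denominator is written as a product of reciprocals to serve as the column
    factors in \<open>det_scale_rows_columns\<close>.\<close>
  have pi: "binom_pi I J = (\<Prod>r<d. of_nat (i (Suc r) choose m)) *
      (\<Prod>s<d. 1 / of_nat (j (Suc s) choose m))"
  proof -
    have prod_eq: "(\<Prod>x\<in>f ` {1..d}. of_nat (x choose m)) =
        (\<Prod>r<d. of_nat (f (Suc r) choose m) :: rat)"
      if "inj_on f {1..d}" for f :: "nat \<Rightarrow> nat"
    proof -
      have "(\<Prod>x\<in>f ` {1..d}. of_nat (x choose m)) = (\<Prod>r = 1..d. of_nat (f r choose m) :: rat)"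
        by (rule prod.reindex_cong[OF that]) simp_all
      also have "\<dots> = (\<Prod>r<d. of_nat (f (Suc r) choose m))"
        by (rule prod.reindex_bij_witness[of _ Suc "\<lambda>r. r - 1"]) auto
      finally show ?thesis .
    qed
    show ?thesis
      unfolding binom_pi_def Min_J unfolding assms(3,5) prod_eq[OF inj(1)] prod_eq[OF inj(2)]
      by (simp add: prod_dividef)
  qed

  have "binom_minor I J = det (mat d d (\<lambda>(r, s). of_nat (i (Suc r) choose j (Suc s))))"
    unfolding assms(3,5) binom_minor_image[OF assms(2,4)] by simp
  also have "mat d d (\<lambda>(r, s). of_nat (i (Suc r) choose j (Suc s))) =
      mat d d (\<lambda>(r, s). of_nat (i (Suc r) choose m) * (1 / of_nat (j (Suc s) choose m)) *
        (of_nat (a r choose b s) :: rat))"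
  proof (rule eq_matI, goal_cases)
    case (1 r s)
    then have rs: "r < d" "s < d"
      by simp_all
    then have "(of_nat (j (Suc s) choose m) :: rat) \<noteq> 0"
      using m_j[of "Suc s"] by simp
    moreover have "of_nat (i (Suc r) choose j (Suc s)) * (of_nat (j (Suc s) choose m) :: rat) =
        of_nat (i (Suc r) choose m) * of_nat (a r choose b s)"
      unfolding of_nat_mult[symmetric] a_def b_def
      using choose_mult_shift[of m "i (Suc r)" "j (Suc s)"] m_i[of "Suc r"] m_j[of "Suc s"] rs
      by simp
    ultimately have "of_nat (i (Suc r) choose j (Suc s)) =
        of_nat (i (Suc r) choose m) * of_nat (a r choose b s) /
          (of_nat (j (Suc s) choose m) :: rat)"
      by (rule eq_divide_imp)
    then show ?case
      using rs by simp
  qed simp_all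
  also have "det \<dots> = binom_pi I J * det (mat d d (\<lambda>(r, s). of_nat (a r choose b s)))"
    unfolding pi by (rule det_scale_rows_columns)
  \<comment> \<open>Column 0 consists of ones because \<open>b 0 = 0\<close>.\<close>
  also have "det (mat d d (\<lambda>(r, s). of_nat (a r choose b s) :: rat)) =
      det (mat n n (\<lambda>(r, s). of_nat (a (Suc r) choose b (Suc s)) - of_nat (a r choose b (Suc s))))"
    unfolding d by (rule det_column_ones) (simp add: b_def m_def)
  also have "mat n n (\<lambda>(r, s).
        of_nat (a (Suc r) choose b (Suc s)) - of_nat (a r choose b (Suc s))) =
      mat n n (\<lambda>(r, s). \<Sum>k\<in>?K (r + 2). of_nat (k choose (b (Suc s) - 1)) :: rat)"
  proof (rule eq_matI, goal_cases)
    case (1 r s)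
    then have rs: "r < n" "s < n"
      by simp_all
    \<comment> \<open>As \<open>b (Suc s) > 0\<close>, it is the successor of
      \<open>b (Suc s) - 1\<close>, which fits the hockey-stick sum.\<close>
    have "a (Suc r) choose b (Suc s) =
        (\<Sum>k\<in>?K (r + 2). k choose (b (Suc s) - 1)) + (a r choose b (Suc s))"
      unfolding K[OF rs(1)]
      using sum_choose_upper_interval[of "a r" "a (Suc r)" "b (Suc s) - 1"] a_less[OF rs(1)]
        b_pos[OF rs(2)]
      by simp
    then show ?case
      using rs by simp
  qed simp_all
  also have "det \<dots> = (\<Sum>k\<in>Pi\<^sub>E {2..d} ?K.
      det (mat n n (\<lambda>(r, s). of_nat (k (r + 2) choose (b (Suc s) - 1)))))"
  \<comment> \<open>Row \<open>r\<close>, counted from 0, belongs to the tuple component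
    k_(r+2).\<close>
  proof (rule det_sum_rows[where g = "\<lambda>r. r + 2" and K = ?K])
    show "bij_betw (\<lambda>r. r + 2) {0..<n} {2..d}"
      by (rule bij_betw_byWitness[of _ "\<lambda>r. r - 2"]) (auto simp: d)
  qed simp
  also have "\<dots> = (\<Sum>k\<in>Pi\<^sub>E {2..d} ?K.
      binom_minor (k ` {2..d}) ((\<lambda>r. j r - j 1 - 1) ` {2..d}))"
    by (rule sum.cong[OF refl minor])
  finally show ?thesis .
qed

end
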